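(* Let $1\le r\le3$, let $x_1,x_2,x_3$ be coordinates on a smooth threefold chart over $\mathbb C$, let $\lambda=(\lambda_1,\dots,\lambda_r)\in\mathbb C^r$, let $$\omega=x_1\cdots x_r\sum_{i=1}^r\lambda_i\frac{dx_i}{x_i},$$ and let $D_{\mathrm{inv}}=(x_1\cdots x_r=0)$. If $$\mathcal R_\lambda:=\{a\in\mathbb Z_{\ge0}^r\setminus\{0\}:\ a_1\lambda_1+\cdots+a_r\lambda_r=0\}$$ is non-empty, then the reduced tangential arc sector centred on $D_{\mathrm{inv}}$ contains arcs whose generic point is not contained in $D_{\mathrm{inv}}$.
   Context: An arc is a morphism $\gamma:\operatorname{Spec}K[[t]]\to W$ ($K/\mathbb C$ a field extension), i.e. in coordinates a triple of power series $x_i(t)$. The reduced tangential arc sector centred on $D_{\mathrm{inv}}$ is the set of arcs $\gamma$ with $\gamma(0)\in D_{\mathrm{inv}}$ and $\gamma^*\omega=0$. The generic point of $\gamma$ is the image of the generic point of $\operatorname{Spec}K[[t]]$; it lies outside $D_{\mathrm{inv}}$ iff $x_1(t)\cdots x_r(t)\neq0$ in $K[[t]]$.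
   Formalization: The chart is assumed to contain a point where x_1=…=x_r=0 (coordinates centred on the stratum); without this the claim fails, e.g. r=2, λ=(1,−1) on the chart x_2≠0, where every tangential arc starting on D_inv stays in D_inv. *)

theory Defs
  imports
    "HOL-Analysis.Analysis"
    "HOL-Library.Poly_Mapping"
    "HOL-Computational_Algebra.Formal_Laurent_Series"
begin

section \<open>Polynomials over \<open>\<complex>\<close> in finitely many variables\<close>

type_synonym 'v cpoly = "('v \<Rightarrow>\<^sub>0 nat) \<Rightarrow>\<^sub>0 complex"

definition Const :: "complex \<Rightarrow> 'v cpoly" where
  "Const c = Poly_Mapping.single 0 c"

definition Var :: "'v \<Rightarrow> 'v cpoly" where
  "Var v = Poly_Mapping.single (Poly_Mapping.single v 1) 1"

text \<open>
  Value of a polynomial at a point \<open>z\<close> with entries in a \<open>\<complex>\<close>-algebra whose structure map is \<open>h\<close>.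
\<close>
definition eval :: "(complex \<Rightarrow> 'b) \<Rightarrow> ('v::finite) cpoly \<Rightarrow> ('v \<Rightarrow> 'b) \<Rightarrow> 'b::comm_ring_1" where
  "eval h P z =
     (\<Sum>m \<in> Poly_Mapping.keys P.
        h (Poly_Mapping.lookup P m) * (\<Prod>v \<in> UNIV. z v ^ Poly_Mapping.lookup m v))"

definition partial :: "'v \<Rightarrow> 'v cpoly \<Rightarrow> 'v cpoly" where
  "partial v P =
     (\<Sum>m \<in> Poly_Mapping.keys P.
        Poly_Mapping.single (m - Poly_Mapping.single v 1)
          (of_nat (Poly_Mapping.lookup m v) * Poly_Mapping.lookup P m))"


section \<open>Smooth threefold charts with coordinates\<close>

text \<open>
  An affine chart \<open>W\<close> with coordinates \<open>x\<^sub>1, x\<^sub>2, x\<^sub>3\<close>, that is, with an etale map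
  \<open>(x\<^sub>1, x\<^sub>2, x\<^sub>3) : W \<rightarrow> \<A>\<^sup>3\<close>, is presented as
  \<open>W = Spec \<complex>[x\<^sub>1, x\<^sub>2, x\<^sub>3, (y\<^sub>j)\<^sub>j] / (f\<^sub>j)\<^sub>j\<close> with as many equations as auxiliary variables
  \<open>y\<^sub>j\<close> and Jacobian determinant \<open>det (\<partial>f\<^sub>j / \<partial>y\<^sub>k)\<close> vanishing nowhere on \<open>W\<close>; every etale
  algebra over a ring has a presentation of this kind over that ring.  Affine space \<open>\<A>\<^sup>3\<close> itself
  is obtained from one auxiliary variable \<open>y\<close> and the equation \<open>y = 0\<close>.

  The ambient variables are indexed by \<open>3 + 'm\<close>: the left summand gives the coordinates, the right
  one the auxiliary variables.
\<close>

text \<open>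
  In the type \<open>3\<close> the numeral \<open>3\<close> equals \<open>0\<close>, so \<open>crd 1\<close>, \<open>crd 2\<close>, \<open>crd 3\<close> are three distinct
  indices exhausting the left summand.
\<close>
definition crd :: "nat \<Rightarrow> 3 + 'm" where
  "crd i = Inl (of_nat i)"

definition on_chart ::
  "('m::finite \<Rightarrow> (3 + 'm) cpoly) \<Rightarrow> (complex \<Rightarrow> 'b) \<Rightarrow> (3 + 'm \<Rightarrow> 'b::comm_ring_1) \<Rightarrow> bool" where
  "on_chart f h z \<longleftrightarrow> (\<forall>j. eval h (f j) z = 0)"

definition smooth_chart :: "('m::finite \<Rightarrow> (3 + 'm) cpoly) \<Rightarrow> bool" where
  "smooth_chart f \<longleftrightarrow>
     (\<forall>p :: 3 + 'm \<Rightarrow> complex. on_chart f id p \<longrightarrow>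
        det (\<chi> j k. eval id (partial (Inr k) (f j)) p) \<noteq> 0)"


section \<open>The divisor and the logarithmic form\<close>

definition on_Dinv :: "nat \<Rightarrow> (complex \<Rightarrow> 'b) \<Rightarrow> (3 + 'm::finite \<Rightarrow> 'b::comm_ring_1) \<Rightarrow> bool" where
  "on_Dinv r h z \<longleftrightarrow> eval h (\<Prod>i = 1..r. Var (crd i)) z = 0"

text \<open>
  The differentials \<open>dx\<^sub>1, dx\<^sub>2, dx\<^sub>3\<close> form a basis of the 1-forms on \<open>W\<close>, and
  \<open>x\<^sub>1 \<cdots> x\<^sub>r \<Sum> \<lambda>\<^sub>i dx\<^sub>i / x\<^sub>i\<close> has the coefficient \<open>\<lambda>\<^sub>i \<Prod>\<^bsub>j \<noteq> i\<^esub> x\<^sub>j\<close> at \<open>dx\<^sub>i\<close> (\<open>i, j \<le> r\<close>).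
\<close>
definition omega :: "nat \<Rightarrow> (nat \<Rightarrow> complex) \<Rightarrow> nat \<Rightarrow> (3 + 'm) cpoly" where
  "omega r lam i =
     (if i \<in> {1..r} then Const (lam i) * (\<Prod>j \<in> {1..r} - {i}. Var (crd j)) else 0)"

definition relations :: "nat \<Rightarrow> (nat \<Rightarrow> complex) \<Rightarrow> (nat \<Rightarrow> nat) set" where
  "relations r lam =
     {a. (\<forall>i. i \<notin> {1..r} \<longrightarrow> a i = 0) \<and> (\<exists>i. a i \<noteq> 0) \<and> (\<Sum>i = 1..r. of_nat (a i) * lam i) = 0}"


section \<open>Arcs\<close>

definition field_extension :: "(complex \<Rightarrow> 'k::field) \<Rightarrow> bool" where
  "field_extension \<iota> \<longleftrightarrow>
     \<iota> 1 = 1 \<and> (\<forall>z w. \<iota> (z + w) = \<iota> z + \<iota> w) \<and> (\<forall>z w. \<iota> (z * w) = \<iota> z * \<iota> w)"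

text \<open>
  A morphism \<open>Spec K[[t]] \<rightarrow> W\<close> over \<open>\<complex>\<close> is a point of \<open>W\<close> with entries in \<open>K[[t]]\<close>.
\<close>
definition is_arc ::
  "('m::finite \<Rightarrow> (3 + 'm) cpoly) \<Rightarrow> (complex \<Rightarrow> 'k::field) \<Rightarrow> (3 + 'm \<Rightarrow> 'k fps) \<Rightarrow> bool" where
  "is_arc f \<iota> \<gamma> \<longleftrightarrow> on_chart f (fps_const \<circ> \<iota>) \<gamma>"

definition closed_point :: "('v \<Rightarrow> 'k fps) \<Rightarrow> 'v \<Rightarrow> 'k::field" where
  "closed_point \<gamma> v = fps_nth (\<gamma> v) 0"

text \<open>The \<open>K((t))\<close>-point of \<open>W\<close> obtained by restricting to the generic point of \<open>Spec K[[t]]\<close>.\<close>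
definition generic_point :: "('v \<Rightarrow> 'k fps) \<Rightarrow> 'v \<Rightarrow> 'k::field fls" where
  "generic_point \<gamma> v = fps_to_fls (\<gamma> v)"

text \<open>Coefficient of \<open>dt\<close> in the pull-back of \<open>\<Sum> w\<^sub>i dx\<^sub>i\<close>.\<close>
definition pullback ::
  "(complex \<Rightarrow> 'k::field) \<Rightarrow> (3 + 'm \<Rightarrow> 'k fps) \<Rightarrow> (nat \<Rightarrow> (3 + 'm::finite) cpoly) \<Rightarrow> 'k fps" where
  "pullback \<iota> \<gamma> w =
     (\<Sum>i = 1..3. eval (fps_const \<circ> \<iota>) (w i) \<gamma> * fps_deriv (\<gamma> (crd i)))"

text \<open>The arcs over a given \<open>K\<close> in the reduced tangential arc sector centred on \<open>D\<^sub>i\<^sub>n\<^sub>v\<close>.\<close>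
definition tangential_sector ::
  "('m::finite \<Rightarrow> (3 + 'm) cpoly) \<Rightarrow> nat \<Rightarrow> (nat \<Rightarrow> complex) \<Rightarrow> (complex \<Rightarrow> 'k::field) \<Rightarrow>
    (3 + 'm \<Rightarrow> 'k fps) set" where
  "tangential_sector f r lam \<iota> =
     {\<gamma>. is_arc f \<iota> \<gamma> \<and> on_Dinv r \<iota> (closed_point \<gamma>) \<and> pullback \<iota> \<gamma> (omega r lam) = 0}"

end

theory Submission
  imports Defs
begin

text \<open>
  Fix a relation \<open>a\<close>.  Since the coordinates \<open>x\<^sub>1, x\<^sub>2, x\<^sub>3\<close> are etale, they take all values near
  \<open>p\<close>; so \<open>W\<close> has a complex point \<open>q\<close> with \<open>x\<^sub>i(q) = 0\<close> if \<open>a\<^sub>i > 0\<close>, with the same value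
  \<open>x\<^sub>i(q) = c \<noteq> 0\<close> at the remaining \<open>i \<le> r\<close>, and with \<open>x\<^sub>i(q) = x\<^sub>i(p)\<close> for \<open>i > r\<close>.  Hensel's lemma
  gives an arc through \<open>q\<close> with \<open>x\<^sub>i(t) = c t\<^bsup>a\<^sub>i\<^esup>\<close> for \<open>i \<le> r\<close> and constant \<open>x\<^sub>i\<close> for \<open>i > r\<close>; on it,
  \<open>t\<close> times the pull-back of \<open>\<omega>\<close> is \<open>x\<^sub>1 \<cdots> x\<^sub>r (\<Sum> \<lambda>\<^sub>i a\<^sub>i) dt = 0\<close>.
\<close>

no_notation fps_nth (infixl \<open>$\<close> 75)

\<comment> \<open>As simp rules these also rewrite the unapplied structure maps in \<open>eval id\<close> and \<open>eval (fps_const \<circ> h)\<close>.\<close>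
declare id_apply [simp del] o_apply [simp del]

section \<open>Evaluation and partial derivatives of polynomials\<close>

lemma poly_mapping_update_eq:
  assumes "a \<notin> Poly_Mapping.keys g"
  shows "Poly_Mapping.update a b g = Poly_Mapping.single a b + g"
  using assms by (intro poly_mapping_eqI)
    (auto simp: lookup_update lookup_add lookup_single in_keys_iff when_def)

text \<open>A finitely supported map arises from zero by updates at fresh keys, and each such update
  adds one monomial.\<close>

lemma poly_mapping_add_induct [case_names single add]:
  assumes single: "\<And>m c. Q (Poly_Mapping.single m c)"
    and add: "\<And>P R. Q P \<Longrightarrow> Q R \<Longrightarrow> Q (P + R)"
  shows "Q P"
proof (induction P rule: update_induct)
  case const
  show ?case using single[of _ 0] by simp
next
  case (update P m c)
  then show ?case by (simp add: poly_mapping_update_eq add single)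
qed

text \<open>A monomial is a constant multiplied by one variable at a time, so inductions about
  derivatives need the product rule only for a variable factor.\<close>

lemma cpoly_induct [case_names Const add Var_mult]:
  fixes P :: "'v cpoly"
  assumes const: "\<And>c. Q (Const c)"
    and add: "\<And>P R. Q P \<Longrightarrow> Q R \<Longrightarrow> Q (P + R)"
    and var: "\<And>v P. Q P \<Longrightarrow> Q (Var v * P)"
  shows "Q P"
proof (induction P rule: poly_mapping_add_induct)
  case (single m c)
  show ?case
  proof (induction m rule: update_induct)
    case const
    show ?case using assms(1) by (simp add: Const_def)
  next
    case (update m v n)
    have "Q (Poly_Mapping.single (Poly_Mapping.single v n + m) c)"
    proof (induction n)
      case 0
      then show ?case using update by simp
    next
      case (Suc n)
      have "Poly_Mapping.single v (Suc n) = Poly_Mapping.single v 1 + Poly_Mapping.single v n"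
        by (simp flip: single_add)
      then have "Poly_Mapping.single (Poly_Mapping.single v (Suc n) + m) c =
          Var v * Poly_Mapping.single (Poly_Mapping.single v n + m) c"
        unfolding Var_def mult_single by (simp only: add.assoc mult_1)
      then show ?case using var[OF Suc] by simp
    qed
    then show ?case using update by (simp add: poly_mapping_update_eq)
  qed
next
  case (add P R)
  then show ?case by (rule assms(2))
qed

text \<open>A larger index set adds only zero terms; one set common to \<open>P\<close>,
  \<open>R\<close> and \<open>P + R\<close> then gives additivity.\<close>

lemma partial_eq_sum:
  assumes "finite S" "Poly_Mapping.keys P \<subseteq> S"
  shows "partial v P = (\<Sum>m\<in>S. Poly_Mapping.single (m - Poly_Mapping.single v 1)
          (of_nat (Poly_Mapping.lookup m v) * Poly_Mapping.lookup P m))"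
  unfolding partial_def using assms by (intro sum.mono_neutral_left) (auto simp: in_keys_iff)

lemma partial_add: "partial v (P + R) = partial v P + partial v R"
proof -
  let ?S = "Poly_Mapping.keys P \<union> Poly_Mapping.keys R"
  show ?thesis
    using keys_add[of P R]
    by (simp add: partial_eq_sum[where S = ?S] lookup_add algebra_simps single_add sum.distrib)
qed

lemma partial_single:
  "partial v (Poly_Mapping.single m c) =
     Poly_Mapping.single (m - Poly_Mapping.single v 1) (of_nat (Poly_Mapping.lookup m v) * c)"
  by (subst partial_eq_sum[where S = "{m}"]) auto

lemma partial_Const [simp]: "partial v (Const c) = 0"
  by (simp add: Const_def partial_single)

lemma partial_Var_mult:
  "partial v (Var w * P) = (if v = w then P else 0) + Var w * partial v P"
proof (induction P rule: poly_mapping_add_induct)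
  case (single m c)
  let ?e = "\<lambda>u. Poly_Mapping.single u (1::nat)"
  show ?case
  proof (cases "v = w")
    case True
    have "?e v + m - ?e v = m" by simp
    \<comment> \<open>Exponents are subtracted with truncation at 0, hence the condition; at
      exponent 0 the derivative of the monomial has coefficient 0.\<close>
    moreover have "?e v + (m - ?e v) = m" if "Poly_Mapping.lookup m v \<noteq> 0"
      using that by (intro poly_mapping_eqI) (auto simp: lookup_add lookup_minus lookup_single when_def)
    ultimately show ?thesis using True
      by (cases "Poly_Mapping.lookup m v = 0")
        (simp_all add: Var_def mult_single partial_single lookup_add algebra_simps flip: single_add)
  next
    case False
    then have "?e w + m - ?e v = ?e w + (m - ?e v)"
      by (intro poly_mapping_eqI) (auto simp: lookup_add lookup_minus lookup_single when_def)
    with False show ?thesis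
      by (simp add: Var_def mult_single partial_single lookup_add lookup_single)
  qed
next
  case (add P R)
  then show ?case by (auto simp: partial_add distrib_left)
qed

text \<open>Instantiated at \<open>\<complex>\<close>, \<open>K\<close>, \<open>K[[t]]\<close> and
  \<open>K((t))\<close>, so that complex points, \<open>K\<close>-points, arcs and generic points
  share one calculus of evaluation.\<close>

locale complex_algebra =
  fixes h :: "complex \<Rightarrow> 'b::comm_ring_1"
  assumes map_1 [simp]: "h 1 = 1"
    and map_add: "h (a + b) = h a + h b"
    and map_mult: "h (a * b) = h a * h b"
begin

lemma map_0 [simp]: "h 0 = 0"
  using map_add[of 0 0] by simp

lemma map_of_nat: "h (of_nat n) = of_nat n"
  by (induction n) (simp_all add: map_add)

lemma map_sum: "h (sum g A) = (\<Sum>x\<in>A. h (g x))"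
  by (induction A rule: infinite_finite_induct) (simp_all add: map_add)

lemma eval_eq_sum:
  assumes "finite S" "Poly_Mapping.keys P \<subseteq> S"
  shows "eval h P z = (\<Sum>m\<in>S. h (Poly_Mapping.lookup P m) *
          (\<Prod>v\<in>UNIV. z v ^ Poly_Mapping.lookup m v))"
  unfolding eval_def using assms by (intro sum.mono_neutral_left) (auto simp: in_keys_iff)

lemma eval_add: "eval h (P + R) z = eval h P z + eval h R z"
proof -
  let ?S = "Poly_Mapping.keys P \<union> Poly_Mapping.keys R"
  show ?thesis
    using keys_add[of P R]
    by (simp add: eval_eq_sum[where S = ?S] lookup_add map_add algebra_simps sum.distrib)
qed

lemma eval_single:
  "eval h (Poly_Mapping.single m c) z = h c * (\<Prod>v\<in>UNIV. z v ^ Poly_Mapping.lookup m v)"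
  by (subst eval_eq_sum[where S = "{m}"]) auto

lemma eval_0 [simp]: "eval h 0 z = 0"
  by (simp add: eval_def)

lemma eval_Const [simp]: "eval h (Const c) z = h c"
  by (simp add: Const_def eval_single)

lemma eval_mult: "eval h (P * R) z = eval h P z * eval h R z"
proof (induction P rule: poly_mapping_add_induct)
  case (single m c)
  show ?case
  proof (induction R rule: poly_mapping_add_induct)
    case (single n d)
    show ?case
      by (simp add: mult_single eval_single map_mult lookup_add power_add prod.distrib)
  next
    case (add P R)
    then show ?case by (simp add: distrib_left eval_add)
  qed
next
  case (add P R)
  then show ?case by (simp add: distrib_right eval_add)
qed

lemma eval_Var [simp]: "eval h (Var v) z = z v"
proof -
  have "(\<Prod>w\<in>UNIV. z w ^ (if v = w then Suc 0 else 0)) = (\<Prod>w\<in>UNIV. if v = w then z w else 1)"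
    by (rule prod.cong) auto
  then show ?thesis
    by (simp add: Var_def eval_single lookup_single when_def)
qed

lemma eval_prod: "eval h (prod g A) z = (\<Prod>x\<in>A. eval h (g x) z)"
proof (induction A rule: infinite_finite_induct)
  case (insert x A)
  then show ?case by (simp add: eval_mult)
qed (use eval_Const[of 1 z] in \<open>simp_all add: Const_def\<close>)

end

text \<open>Both sides respect sums and products in \<open>P\<close> and agree on constants and
  variables. It serves the constant-term map of power series and the embedding
  \<open>\<iota>\<close>.\<close>

lemma eval_hom:
  assumes "complex_algebra h" "complex_algebra (\<lambda>c. \<phi> (h c))"
    and add: "\<And>a b. \<phi> (a + b) = \<phi> a + \<phi> b" and mult: "\<And>a b. \<phi> (a * b) = \<phi> a * \<phi> b"
  shows "\<phi> (eval h P z) = eval (\<lambda>c. \<phi> (h c)) P (\<lambda>v. \<phi> (z v))"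
proof -
  interpret h: complex_algebra h by fact
  interpret k: complex_algebra "\<lambda>c. \<phi> (h c)" by fact
  show ?thesis
    by (induction P rule: cpoly_induct)
      (simp_all add: h.eval_add k.eval_add h.eval_mult k.eval_mult add mult)
qed

interpretation id_algebra: complex_algebra id
  by unfold_locales (auto simp: id_apply)

section \<open>Complex points of the chart\<close>

text \<open>Links the formal \<open>partial\<close> to analysis: the analytic product rule for a
  variable factor has the shape of \<open>partial_Var_mult\<close>.\<close>

lemma eval_has_derivative:
  fixes x :: "complex ^ 'v::finite"
  shows "((\<lambda>x. eval id P (($) x)) has_derivative
     (\<lambda>u. \<Sum>v\<in>UNIV. eval id (partial v P) (($) x) * u $ v)) (at x)"
proof (induction P rule: cpoly_induct)
  case (Const c)
  then show ?case by simp
next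
  case (add P R)
  show ?case
    by (rule has_derivative_eq_rhs, simp only: id_algebra.eval_add, rule has_derivative_add[OF add.IH])
      (simp add: partial_add id_algebra.eval_add distrib_right sum.distrib)
next
  case (Var_mult w P)
  have "((\<lambda>x :: complex ^ 'v. x $ w) has_derivative (\<lambda>u. u $ w)) (at x)"
    by (intro bounded_linear_imp_has_derivative bounded_linear_vec_nth)
  note D = has_derivative_mult[OF this Var_mult.IH]
  have "(\<Sum>v\<in>UNIV. eval id (if v = w then P else 0) (($) x) * u $ v) = u $ w * eval id P (($) x)" for u
    by (subst sum.remove[of UNIV w]) auto
  then have R: "(\<lambda>u. x $ w * (\<Sum>v\<in>UNIV. eval id (partial v P) (($) x) * u $ v) + u $ w * eval id P (($) x)) =
      (\<lambda>u. \<Sum>v\<in>UNIV. eval id (partial v (Var w * P)) (($) x) * u $ v)"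
    by (simp add: fun_eq_iff partial_Var_mult id_algebra.eval_add id_algebra.eval_mult distrib_right
        sum.distrib sum_distrib_left mult.assoc)
  show ?case
    using D unfolding R by (simp add: id_algebra.eval_mult)
qed

lemma has_derivative_cart_componentwise:
  fixes g :: "_ \<Rightarrow> 'c::euclidean_space ^ 'i"
  assumes "\<And>i. ((\<lambda>x. g x $ i) has_derivative (\<lambda>u. g' u $ i)) (at x)"
  shows "(g has_derivative g') (at x)"
  unfolding has_derivative_componentwise_within[of g]
  using assms by (auto simp: Basis_vec_def inner_axis intro!: has_derivative_inner_left)

lemma sum_UNIV_Plus:
  fixes g :: "'x::finite + 'y::finite \<Rightarrow> 'c::comm_monoid_add"
  shows "(\<Sum>v\<in>UNIV. g v) = (\<Sum>k\<in>UNIV. g (Inl k)) + (\<Sum>j\<in>UNIV. g (Inr j))"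
  using sum.Plus[of UNIV UNIV g] by (simp add: o_def)

text \<open>The Jacobian determinant is nonzero at \<open>p\<close>. The inverse is given by its
  entries, to which \<open>\<iota>\<close> can later be applied one by one.\<close>

lemma smooth_chart_right_inverse:
  assumes "smooth_chart f" "on_chart f id p"
  obtains B where "\<And>l i. (\<Sum>j\<in>UNIV. eval id (partial (Inr j) (f l)) p * B j i) = (if l = i then 1 else 0)"
proof -
  define J :: "complex ^ _ ^ _" where "J = (\<chi> l j. eval id (partial (Inr j) (f l)) p)"
  have "invertible J"
    using assms unfolding smooth_chart_def J_def invertible_det_nz by blast
  then obtain B where "J ** B = mat 1"
    by (auto simp: invertible_def)
  then have "(J ** B) $ l $ i = (if l = i then 1 else 0)" for l i
    by (simp add: mat_def)
  then show thesis
    by (intro that[of "\<lambda>j i. B $ j $ i"]) (simp add: matrix_matrix_mult_def J_def)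
qed

text \<open>The map \<open>(x, y) \<mapsto> (x, f(x, y))\<close> has a block triangular derivative
  at \<open>p\<close> whose Jacobian block is invertible, so its image contains a neighbourhood of
  \<open>(x(p), 0)\<close>. A preimage of \<open>(x, 0)\<close> is a point of the chart over
  \<open>x\<close>.\<close>

lemma chart_points_near:
  assumes f: "smooth_chart f" and p: "on_chart f id p"
  shows "\<forall>\<^sub>F x :: complex ^ 3 in nhds (\<chi> k. p (Inl k)).
           \<exists>q. on_chart f id q \<and> (\<forall>k. q (Inl k) = x $ k)"
proof -
  obtain B where B: "\<And>l i. (\<Sum>j\<in>UNIV. eval id (partial (Inr j) (f l)) p * B j i) = (if l = i then 1 else 0)"
    using smooth_chart_right_inverse[OF f p] by blast
  define P :: "complex ^ (3 + 'a)" where "P = (\<chi> v. p v)"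
  have P [simp]: "P $ v = p v" "($) P = p" for v by (auto simp: P_def)
  define F :: "complex ^ (3 + 'a) \<Rightarrow> complex ^ (3 + 'a)"
    where "F z = (\<chi> v. case v of Inl k \<Rightarrow> z $ Inl k | Inr j \<Rightarrow> eval id (f j) (($) z))" for z
  define F' :: "complex ^ (3 + 'a) \<Rightarrow> complex ^ (3 + 'a) \<Rightarrow> complex ^ (3 + 'a)"
    where "F' z u = (\<chi> v. case v of Inl k \<Rightarrow> u $ Inl k
       | Inr j \<Rightarrow> (\<Sum>v\<in>UNIV. eval id (partial v (f j)) (($) z) * u $ v))" for z u
  \<comment> \<open>\<open>G\<close> inverts the derivative blockwise: it keeps the coordinates and
    applies \<open>B\<close> to the auxiliary part minus the contribution of the
    coordinates.\<close>
  define rest where "rest u l = u $ Inr l - (\<Sum>k\<in>UNIV. eval id (partial (Inl k) (f l)) p * u $ Inl k)"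
    for u :: "complex ^ (3 + 'a)" and l
  define G :: "complex ^ (3 + 'a) \<Rightarrow> complex ^ (3 + 'a)"
    where "G u = (\<chi> v. case v of Inl k \<Rightarrow> u $ Inl k | Inr j \<Rightarrow> (\<Sum>l\<in>UNIV. B j l * rest u l))" for u
  have F': "(F has_derivative F' z) (at z)" for z
  proof (rule has_derivative_cart_componentwise)
    fix v :: "3 + 'a"
    show "((\<lambda>x. F x $ v) has_derivative (\<lambda>u. F' z u $ v)) (at z)"
      by (cases v) (auto simp: F_def F'_def eval_has_derivative
          intro!: bounded_linear_imp_has_derivative bounded_linear_vec_nth)
  qed
  have rest: "rest (u + v) l = rest u l + rest v l" "rest (c *\<^sub>R u) l = c *\<^sub>R rest u l" for u v l c
    by (simp_all add: rest_def algebra_simps sum.distrib scaleR_sum_right)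
  have "linear G"
    by (rule linearI) (auto simp: G_def vec_eq_iff rest distrib_left sum.distrib scaleR_sum_right
        split: sum.split)
  moreover have "F' P \<circ> G = id"
  proof
    fix u
    have "(\<Sum>v\<in>UNIV. eval id (partial v (f i)) p * G u $ v) = u $ Inr i" for i
    proof -
      have "(\<Sum>j\<in>UNIV. eval id (partial (Inr j) (f i)) p * (\<Sum>l\<in>UNIV. B j l * rest u l)) =
          (\<Sum>l\<in>UNIV. (\<Sum>j\<in>UNIV. eval id (partial (Inr j) (f i)) p * B j l) * rest u l)"
        by (simp add: sum_distrib_left sum_distrib_right mult.assoc) (rule sum.swap)
      also have "\<dots> = rest u i"
        unfolding B by (simp add: if_distrib[of "\<lambda>x. x * _"] cong: if_cong)
      finally show ?thesis
        by (simp add: sum_UNIV_Plus G_def rest_def)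
    qed
    then show "(F' P \<circ> G) u = id u"
      by (auto simp: F'_def vec_eq_iff G_def o_apply id_apply split: sum.split)
  qed
  \<comment> \<open>Open mapping theorem, from the right inverse \<open>G\<close> of the derivative
    at \<open>P\<close>.\<close>
  ultimately have I: "F P \<in> interior (range F)"
    using F' by (intro sussmann_open_mapping[where S = UNIV and f' = "F' P" and g' = G])
      (auto intro: has_derivative_continuous continuous_at_imp_continuous_on
        simp flip: linear_conv_bounded_linear)
  \<comment> \<open>\<open>E\<close> embeds coordinate space as the slice with zero auxiliary part;
    \<open>F z\<close> lies in it exactly when \<open>z\<close> satisfies all equations.\<close>
  define E :: "complex ^ 3 \<Rightarrow> complex ^ (3 + 'a)"
    where "E x = (\<chi> v. case v of Inl k \<Rightarrow> x $ k | Inr j \<Rightarrow> 0)" for x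
  have "linear E"
    by (rule linearI) (auto simp: E_def vec_eq_iff split: sum.split)
  then have "continuous_on UNIV E"
    by (simp add: linear_continuous_on linear_conv_bounded_linear)
  then have "open (E -` interior (range F))"
    by (simp add: continuous_on_open_vimage)
  moreover have "E (\<chi> k. p (Inl k)) = F P"
    using p by (auto simp: E_def F_def vec_eq_iff on_chart_def split: sum.split)
  ultimately have "\<forall>\<^sub>F x in nhds (\<chi> k. p (Inl k)). x \<in> E -` interior (range F)"
    using I by (intro eventually_nhds_in_open) auto
  then show ?thesis
  proof (rule eventually_mono)
    fix x assume "x \<in> E -` interior (range F)"
    then obtain z where z: "E x = F z"
      using interior_subset by auto
    then have "E x $ v = F z $ v" for v by simp
    from this[of "Inl _"] this[of "Inr _"]
    show "\<exists>q. on_chart f id q \<and> (\<forall>k. q (Inl k) = x $ k)"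
      by (intro exI[of _ "($) z"]) (simp add: E_def F_def on_chart_def)
  qed
qed

section \<open>Hensel lifting\<close>

lemma complex_algebra_fps_const:
  "complex_algebra h \<Longrightarrow> complex_algebra (fps_const \<circ> h)"
  by (simp add: complex_algebra_def o_apply)

lemma fps_nth_mult_eqI:
  fixes a b :: "'b::comm_ring_1 fps"
  assumes "\<And>k. k < n \<Longrightarrow> fps_nth a k = fps_nth b k" "\<And>k. k < n \<Longrightarrow> fps_nth c k = fps_nth d k" "k < n"
  shows "fps_nth (a * c) k = fps_nth (b * d) k"
  using assms unfolding fps_mult_nth by (intro sum.cong refl) auto

text \<open>Only the two outer terms of the Cauchy product involve a coefficient of index
  \<open>n\<close>; the inner terms cancel.\<close>

lemma fps_nth_mult_diff:
  fixes a b :: "'b::comm_ring_1 fps"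
  assumes a: "\<And>k. k < n \<Longrightarrow> fps_nth a k = fps_nth b k"
    and c: "\<And>k. k < n \<Longrightarrow> fps_nth c k = fps_nth d k" and n: "0 < n"
  shows "fps_nth (a * c) n - fps_nth (b * d) n =
     (fps_nth a n - fps_nth b n) * fps_nth d 0 + fps_nth b 0 * (fps_nth c n - fps_nth d n)"
proof -
  have split: "fps_nth (u * v) n = fps_nth u 0 * fps_nth v n + fps_nth u n * fps_nth v 0 +
      (\<Sum>i\<in>{0<..<n}. fps_nth u i * fps_nth v (n - i))" for u v :: "'b fps"
  proof -
    have "{0..n} = insert 0 (insert n {0<..<n})" using n by auto
    then show ?thesis using n by (simp add: fps_mult_nth add.assoc)
  qed
  have "(\<Sum>i\<in>{0<..<n}. fps_nth a i * fps_nth c (n - i)) = (\<Sum>i\<in>{0<..<n}. fps_nth b i * fps_nth d (n - i))"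
    using a c by (intro sum.cong) auto
  moreover have "fps_nth a 0 = fps_nth b 0" "fps_nth c 0 = fps_nth d 0"
    using a c n by auto
  ultimately show ?thesis by (simp add: split algebra_simps)
qed

lemma fps_nth_0_eval:
  assumes "complex_algebra h"
  shows "fps_nth (eval (fps_const \<circ> h) P z) 0 = eval h P (\<lambda>v. fps_nth (z v) 0)"
  using eval_hom[OF complex_algebra_fps_const[OF assms], of "\<lambda>x. fps_nth x 0" P z] assms by (simp add: o_def)

lemma eval_fps_nth_eqI:
  assumes "complex_algebra h" and "\<And>v k. k < n \<Longrightarrow> fps_nth (z v) k = fps_nth (w v) k" and "k < n"
  shows "fps_nth (eval (fps_const \<circ> h) P z) k = fps_nth (eval (fps_const \<circ> h) P w) k"
proof -
  interpret H: complex_algebra "fps_const \<circ> h"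
    using assms(1) by (rule complex_algebra_fps_const)
  show ?thesis using \<open>k < n\<close>
  proof (induction P arbitrary: k rule: cpoly_induct)
    case (Var_mult v P)
    then show ?case
      using assms by (auto simp: H.eval_mult intro!: fps_nth_mult_eqI[where n = n])
  qed (auto simp: H.eval_add)
qed

text \<open>Taylor expansion: \<open>z - w\<close> is divisible by \<open>t^n\<close>, so its
  quadratic terms start at \<open>t^(2n)\<close> and miss coefficient \<open>n\<close>, as
  \<open>n > 0\<close>. The linear term sees the partial derivatives only through their constant
  terms.\<close>

lemma eval_fps_nth_diff:
  assumes h: "complex_algebra h" and zw: "\<And>v k. k < n \<Longrightarrow> fps_nth (z v) k = fps_nth (w v) k"
    and n: "0 < n"
  shows "fps_nth (eval (fps_const \<circ> h) P z) n - fps_nth (eval (fps_const \<circ> h) P w) n =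
    (\<Sum>v\<in>UNIV. eval h (partial v P) (\<lambda>v. fps_nth (w v) 0) * (fps_nth (z v) n - fps_nth (w v) n))"
proof -
  interpret H: complex_algebra "fps_const \<circ> h"
    using h by (rule complex_algebra_fps_const)
  interpret h: complex_algebra h by fact
  show ?thesis
  proof (induction P rule: cpoly_induct)
    case (Const c)
    then show ?case by simp
  next
    case (add P R)
    then show ?case
      by (simp add: add_diff_add H.eval_add h.eval_add partial_add distrib_right sum.distrib)
  next
    case (Var_mult u P)
    have "(\<Sum>v\<in>UNIV. eval h (if v = u then P else 0) (\<lambda>v. fps_nth (w v) 0) * (fps_nth (z v) n - fps_nth (w v) n)) =
        (fps_nth (z u) n - fps_nth (w u) n) * eval h P (\<lambda>v. fps_nth (w v) 0)"
      by (subst sum.remove[of UNIV u]) auto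
    moreover have "fps_nth (z u * eval (fps_const \<circ> h) P z) n - fps_nth (w u * eval (fps_const \<circ> h) P w) n =
        (fps_nth (z u) n - fps_nth (w u) n) * fps_nth (eval (fps_const \<circ> h) P w) 0 + fps_nth (w u) 0 *
        (fps_nth (eval (fps_const \<circ> h) P z) n - fps_nth (eval (fps_const \<circ> h) P w) n)"
      using zw n by (intro fps_nth_mult_diff eval_fps_nth_eqI[OF h]) auto
    ultimately show ?case
      using Var_mult
      by (simp add: H.eval_mult h.eval_mult h.eval_add partial_Var_mult distrib_right sum.distrib
          sum_distrib_left mult.assoc fps_nth_0_eval[OF h])
  qed
qed

text \<open>
  Newton's method with the Jacobian matrix frozen at the closed point: each step makes one more
  coefficient of the equations vanish.
\<close>
lemma hensel_lift:
  fixes f :: "'m::finite \<Rightarrow> (3 + 'm) cpoly" and x :: "3 \<Rightarrow> 'k::field fps"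
  assumes h: "complex_algebra h" and q: "on_chart f h q"
    and B: "\<And>l i. (\<Sum>j\<in>UNIV. eval h (partial (Inr j) (f l)) q * B j i) = (if l = i then 1 else 0)"
    and x: "\<And>k. fps_nth (x k) 0 = q (Inl k)"
  obtains \<gamma> where "is_arc f h \<gamma>" "\<And>k. \<gamma> (Inl k) = x k" "closed_point \<gamma> = q"
proof -
  interpret h: complex_algebra h by fact
  let ?H = "fps_const \<circ> h"
  define z where "z y v = (case v of Inl k \<Rightarrow> x k | Inr j \<Rightarrow> y j)" for y :: "'m \<Rightarrow> 'k fps" and v
  have z: "z y (Inl k) = x k" "z y (Inr j) = y j" for y k j
    by (simp_all add: z_def)
  \<comment> \<open>\<open>Y n\<close> is to solve the equations modulo \<open>t^(n+1)\<close>; the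
    next step cancels their coefficient at \<open>t^(n+1)\<close>.\<close>
  define Y where "Y = rec_nat (\<lambda>j. fps_const (q (Inr j)))
    (\<lambda>n y j. y j - fps_const (\<Sum>l\<in>UNIV. B j l * fps_nth (eval ?H (f l) (z y)) (Suc n)) * fps_X ^ Suc n)"
  have Y0: "Y 0 = (\<lambda>j. fps_const (q (Inr j)))"
    by (simp add: Y_def)
  have YS: "Y (Suc n) j =
      Y n j - fps_const (\<Sum>l\<in>UNIV. B j l * fps_nth (eval ?H (f l) (z (Y n))) (Suc n)) * fps_X ^ Suc n" for n j
    by (simp add: Y_def)
  \<comment> \<open>The correction is a multiple of \<open>t^(n+1)\<close>, so coefficients up to
    \<open>n\<close> are final from stage \<open>n\<close> on.\<close>
  have stable: "fps_nth (Y (Suc n) j) k = fps_nth (Y n j) k" if "k \<le> n" for n j k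
    using that by (simp add: YS fps_X_power_iff del: power_Suc)
  have stable': "fps_nth (Y m j) k = fps_nth (Y n j) k" if "k \<le> n" "n \<le> m" for m n j k
    using \<open>n \<le> m\<close> by (induction m rule: dec_induct) (use \<open>k \<le> n\<close> in \<open>auto simp: stable\<close>)
  have at0: "(\<lambda>v. fps_nth (z (Y n) v) 0) = q" for n
    using x by (auto simp: z_def stable'[of 0 0 n] Y0 split: sum.split)
  have vanish: "fps_nth (eval ?H (f l) (z (Y n))) k = 0" if "k \<le> n" for n l k
    using that
  proof (induction n arbitrary: k l)
    case 0
    then show ?case
      using q by (simp add: fps_nth_0_eval[OF h] at0 on_chart_def)
  next
    case (Suc n)
    have agree: "fps_nth (z (Y (Suc n)) v) k = fps_nth (z (Y n) v) k" if "k < Suc n" for v k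
      using that by (auto simp: z_def stable split: sum.split)
    show ?case
    proof (cases "k \<le> n")
      case True
      then show ?thesis
        using Suc.IH
          eval_fps_nth_eqI[OF h, of "Suc n" "z (Y (Suc n))" "z (Y n)" k "f l"] agree by simp
    next
      case False
      \<comment> \<open>Here \<open>k = Suc n\<close>. By the Taylor formula the correction
        \<open>- B e\<close> changes the coefficient vector \<open>e\<close> by
        \<open>- J B e = - e\<close>, where \<open>J\<close> is the Jacobian at
        \<open>q\<close>.\<close>
      let ?e = "\<lambda>i. fps_nth (eval ?H (f i) (z (Y n))) (Suc n)"
      have "fps_nth (eval ?H (f l) (z (Y (Suc n)))) (Suc n) - ?e l =
         - (\<Sum>j\<in>UNIV. eval h (partial (Inr j) (f l)) q * (\<Sum>i\<in>UNIV. B j i * ?e i))"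
        by (simp add: eval_fps_nth_diff[OF h agree] at0 sum_UNIV_Plus z YS sum_negf
            del: power_Suc)
      also have "(\<Sum>j\<in>UNIV. eval h (partial (Inr j) (f l)) q * (\<Sum>i\<in>UNIV. B j i * ?e i)) =
         (\<Sum>i\<in>UNIV. (\<Sum>j\<in>UNIV. eval h (partial (Inr j) (f l)) q * B j i) * ?e i)"
        by (simp add: sum_distrib_left sum_distrib_right mult.assoc) (rule sum.swap)
      also have "\<dots> = ?e l"
        unfolding B by (simp add: if_distrib[of "\<lambda>x. x * _"] cong: if_cong)
      finally show ?thesis
        using False Suc.prems by (simp add: le_Suc_eq)
    qed
  qed
  \<comment> \<open>The limit of the stabilising sequence, read off along the diagonal.\<close>
  define y where "y j = Abs_fps (\<lambda>k. fps_nth (Y k j) k)" for j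
  have y: "fps_nth (y j) k = fps_nth (Y n j) k" if "k \<le> n" for j k n
    using that by (simp add: y_def stable'[of k k n])
  have "fps_nth (eval ?H (f l) (z y)) n = 0" for l n
  proof -
    have "fps_nth (eval ?H (f l) (z y)) n = fps_nth (eval ?H (f l) (z (Y n))) n"
      by (rule eval_fps_nth_eqI[OF h, where n = "Suc n"]) (auto simp: z_def y split: sum.split)
    then show ?thesis by (simp add: vanish)
  qed
  then have "is_arc f h (z y)"
    by (simp add: is_arc_def on_chart_def fps_eq_iff)
  moreover have "closed_point (z y) = q"
    using at0[of 0] by (auto simp: closed_point_def z_def y[of 0 0] fun_eq_iff split: sum.splits)
  ultimately show thesis
    by (intro that[of "z y"]) (auto simp: z_def)
qed

section \<open>The arc attached to a relation\<close>

text \<open>Monomials are eigenvectors of the Euler operator \<open>t d/dt\<close>; the factor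
  \<open>t\<close> avoids the exponent \<open>n - 1\<close>, so \<open>n = 0\<close> needs no
  separate form.\<close>

lemma fps_X_mult_deriv_monomial:
  "fps_X * fps_deriv (fps_const c * fps_X ^ n) = fps_const (of_nat n) * (fps_const c * fps_X ^ n)"
  for c :: "'b::comm_ring_1"
  by (auto simp: fps_eq_iff fps_X_power_iff of_nat_diff)

text \<open>The type \<open>3\<close> counts modulo 3 while coordinates are numbered from 1 to 3;
  \<open>ix\<close> picks the representative in that range, with 3 standing for the index 0.\<close>

lemma crd_enum:
  obtains ix :: "3 \<Rightarrow> nat" where "\<And>k. of_nat (ix k) = k" "\<And>i. i \<in> {1..3} \<Longrightarrow> ix (of_nat i) = i"
    "\<And>k. ix k \<in> {1..3}"
proof -
  define ix :: "3 \<Rightarrow> nat" where "ix k = (if k = 1 then 1 else if k = 2 then 2 else 3)" for k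
  have "of_nat (ix k) = k" for k
    using exhaust_3[of k] by (auto simp: ix_def)
  moreover have "ix (of_nat i) = i" if "i \<in> {1..3}" for i
  proof -
    have "i = 1 \<or> i = 2 \<or> i = 3" using that by auto
    then show ?thesis by (auto simp: ix_def)
  qed
  ultimately show thesis by (intro that[of ix]) (auto simp: ix_def)
qed

theorem proposition4p3:
  fixes f :: "'m::finite \<Rightarrow> (3 + 'm) cpoly"
    and p :: "3 + 'm \<Rightarrow> complex"
    and r :: nat
    and lam :: "nat \<Rightarrow> complex"
    and \<iota> :: "complex \<Rightarrow> 'k::field"
  assumes r: "1 \<le> r" "r \<le> 3"
    and chart: "smooth_chart f"
    and centre: "on_chart f id p" "\<forall>i \<in> {1..r}. p (crd i) = 0"
    and K: "field_extension \<iota>"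
    and relation: "relations r lam \<noteq> {}"
  shows "\<exists>\<gamma> \<in> tangential_sector f r lam \<iota>.
           \<not> on_Dinv r (fls_const \<circ> \<iota>) (generic_point \<gamma>)"
proof -
  interpret \<iota>: complex_algebra \<iota>
    using K by unfold_locales (auto simp: field_extension_def)
  interpret H: complex_algebra "fps_const \<circ> \<iota>"
    by (rule complex_algebra_fps_const) unfold_locales
  interpret L: complex_algebra "fls_const \<circ> \<iota>"
    by unfold_locales (auto simp: \<iota>.map_add \<iota>.map_mult o_apply fls_plus_const)
  \<comment> \<open>Injectivity of a field homomorphism; it keeps the leading coefficient
    \<open>\<iota> c\<close> nonzero.\<close>
  have \<iota>_eq_0: "\<iota> c = 0 \<longleftrightarrow> c = 0" for c
  proof
    assume "\<iota> c = 0"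
    then have "c \<noteq> 0 \<Longrightarrow> \<iota> (c * inverse c) = 0"
      by (simp only: \<iota>.map_mult mult_zero_left)
    then show "c = 0" by (cases "c = 0") auto
  qed simp
  obtain a where a: "\<And>i. i \<notin> {1..r} \<Longrightarrow> a i = 0" and "\<exists>i. a i \<noteq> 0"
    and rel: "(\<Sum>i = 1..r. of_nat (a i) * lam i) = 0"
    using relation unfolding relations_def by auto
  then obtain i0 where i0: "i0 \<in> {1..r}" "a i0 \<noteq> 0" by metis
  obtain ix :: "3 \<Rightarrow> nat" where ix: "\<And>k. of_nat (ix k) = k" "\<And>i. i \<in> {1..3} \<Longrightarrow> ix (of_nat i) = i"
    "\<And>k. ix k \<in> {1..3}"
    by (rule crd_enum) blast

  \<comment> \<open>The intended arc has coordinates \<open>d c k * t^(a (ix k))\<close>, and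
    \<open>?E c\<close> is its value at \<open>t = 0\<close>, because \<open>0 ^ 0 = 1\<close>. At
    \<open>c = 0\<close> this is the coordinate vector of \<open>p\<close>.\<close>
  define d where "d c k = (if ix k \<le> r then c else p (Inl k))" for c k
  let ?E = "\<lambda>c. \<chi> k. d c k * 0 ^ a (ix k)"
  have "p (Inl k) = 0" if "ix k \<le> r" for k
    using bspec[OF centre(2), of "ix k"] ix(1,3)[of k] that by (simp add: crd_def)
  then have "?E 0 = (\<chi> k. p (Inl k))"
    using a by (auto simp: vec_eq_iff d_def)
  moreover have "(?E \<longlongrightarrow> ?E 0) (at 0)"
    by (intro tendsto_vec_lambda) (auto simp: d_def intro!: tendsto_eq_intros)
  ultimately have "\<forall>\<^sub>F c in at 0. \<exists>q. on_chart f id q \<and> (\<forall>k. q (Inl k) = ?E c $ k)"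
    using eventually_compose_filterlim[OF chart_points_near[OF chart centre(1)], of ?E "at 0"] by simp
  \<comment> \<open>The filter \<open>at 0\<close> is punctured and nontrivial, so a suitable
    \<open>c\<close> exists that is nonzero.\<close>
  then have "\<forall>\<^sub>F c in at 0. c \<noteq> 0 \<and> (\<exists>q. on_chart f id q \<and> (\<forall>k. q (Inl k) = ?E c $ k))"
    using eventually_neq_at_within by eventually_elim auto
  then obtain c q where c: "c \<noteq> 0" and q: "on_chart f id q" "\<And>k. q (Inl k) = d c k * 0 ^ a (ix k)"
    by (auto dest!: eventually_happens)

  \<comment> \<open>Smoothness is applied afresh at \<open>q\<close>, which may differ from
    \<open>p\<close>; then \<open>q\<close>, its equations and \<open>B\<close> are carried to
    \<open>K\<close> by \<open>\<iota>\<close>.\<close>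
  obtain B where B: "\<And>l i. (\<Sum>j\<in>UNIV. eval id (partial (Inr j) (f l)) q * B j i) = (if l = i then 1 else 0)"
    using smooth_chart_right_inverse[OF chart q(1)] by blast
  have \<iota>_eval: "\<iota> (eval id P q) = eval \<iota> P (\<lambda>v. \<iota> (q v))" for P
    using eval_hom[OF id_algebra.complex_algebra_axioms, of \<iota> P q] \<iota>.complex_algebra_axioms
    by (simp add: \<iota>.map_add \<iota>.map_mult) (simp add: id_def)
  have "on_chart f \<iota> (\<lambda>v. \<iota> (q v))"
    using q(1) by (simp add: on_chart_def flip: \<iota>_eval)
  moreover have "(\<Sum>j\<in>UNIV. eval \<iota> (partial (Inr j) (f l)) (\<lambda>v. \<iota> (q v)) * \<iota> (B j i)) = (if l = i then 1 else 0)" for l i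
    using arg_cong[OF B[of l i], of \<iota>] by (simp add: \<iota>.map_sum \<iota>.map_mult \<iota>_eval split: if_splits)
  moreover have "fps_nth (fps_const (\<iota> (d c k)) * fps_X ^ a (ix k)) 0 = \<iota> (q (Inl k))" for k
    by (cases "a (ix k)") (simp_all add: q(2))
  ultimately obtain \<gamma> where arc: "is_arc f \<iota> \<gamma>"
    and x: "\<And>k. \<gamma> (Inl k) = fps_const (\<iota> (d c k)) * fps_X ^ a (ix k)"
    and closed: "closed_point \<gamma> = (\<lambda>v. \<iota> (q v))"
    using hensel_lift[OF \<iota>.complex_algebra_axioms, of f "\<lambda>v. \<iota> (q v)" "\<lambda>j i. \<iota> (B j i)"
      "\<lambda>k. fps_const (\<iota> (d c k)) * fps_X ^ a (ix k)"]
    by blast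
  have xr: "\<gamma> (crd i) = fps_const (\<iota> c) * fps_X ^ a i" if "i \<in> {1..r}" for i
    using that r ix(2)[of i] by (simp add: crd_def x d_def)

  have "on_Dinv r \<iota> (closed_point \<gamma>)"
  proof -
    have "closed_point \<gamma> (crd i0) = 0"
      using i0 r ix(2)[of i0] by (simp add: closed crd_def q(2) power_0_left)
    then show ?thesis
      using i0(1) by (auto simp: on_Dinv_def \<iota>.eval_prod)
  qed
  moreover have "pullback \<iota> \<gamma> (omega r lam) = 0"
  proof -
    let ?D = "\<Prod>j = 1..r. \<gamma> (crd j)"
    have Xderiv: "fps_X * fps_deriv (\<gamma> (crd i)) = fps_const (\<iota> (of_nat (a i))) * \<gamma> (crd i)" if "i \<in> {1..r}" for i
      using that by (simp only: xr fps_X_mult_deriv_monomial \<iota>.map_of_nat)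
    have "pullback \<iota> \<gamma> (omega r lam) =
       (\<Sum>i = 1..r. eval (fps_const \<circ> \<iota>) (omega r lam i) \<gamma> * fps_deriv (\<gamma> (crd i)))"
      unfolding pullback_def using r by (intro sum.mono_neutral_right) (auto simp: omega_def)
    \<comment> \<open>Multiplying by \<open>t\<close> turns \<open>dx_i/dt\<close> into
      \<open>a_i x_i / t\<close> times \<open>t\<close>; the factor \<open>x_i\<close> completes the
      coefficient of \<open>\<omega>\<close> to the full product \<open>?D\<close>.\<close>
    then have "fps_X * pullback \<iota> \<gamma> (omega r lam) =
       (\<Sum>i = 1..r. eval (fps_const \<circ> \<iota>) (omega r lam i) \<gamma> * (fps_X * fps_deriv (\<gamma> (crd i))))"
      by (simp add: sum_distrib_left mult_ac)
    also have "\<dots> = (\<Sum>i = 1..r. fps_const (\<iota> (of_nat (a i) * lam i)) * ?D)"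
    proof (rule sum.cong)
      fix i assume i: "i \<in> {1..r}"
      then have "?D = \<gamma> (crd i) * (\<Prod>j\<in>{1..r} - {i}. \<gamma> (crd j))"
        by (simp add: prod.remove)
      with i show "eval (fps_const \<circ> \<iota>) (omega r lam i) \<gamma> * (fps_X * fps_deriv (\<gamma> (crd i))) =
          fps_const (\<iota> (of_nat (a i) * lam i)) * ?D"
        by (simp add: Xderiv omega_def H.eval_mult H.eval_prod \<iota>.map_mult o_apply mult_ac flip: fps_const_mult)
    qed simp
    also have "\<dots> = (fps_const \<circ> \<iota>) (\<Sum>i = 1..r. of_nat (a i) * lam i) * ?D"
      using H.map_sum[of "\<lambda>i. of_nat (a i) * lam i" "{1..r}"]
      by (simp only: o_apply sum_distrib_right)
    also have "\<dots> = 0"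
      by (simp only: rel H.map_0 mult_zero_left)
    \<comment> \<open>\<open>K[[t]]\<close> is a domain, so the factor \<open>t\<close>
      cancels.\<close>
    finally show ?thesis by simp
  qed
  moreover have "\<not> on_Dinv r (fls_const \<circ> \<iota>) (generic_point \<gamma>)"
  proof -
    \<comment> \<open>Each of the first \<open>r\<close> coordinates is a nonzero monomial in the
      field \<open>K((t))\<close>, hence so is their product.\<close>
    have "generic_point \<gamma> (crd i) \<noteq> 0" if "i \<in> {1..r}" for i
      using c that by (simp add: generic_point_def xr \<iota>_eq_0)
    then show ?thesis
      by (simp add: on_Dinv_def L.eval_prod)
  qed
  ultimately show ?thesis
    using arc unfolding tangential_sector_def by blast
qed

end
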